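(* Let $D$ be a digraph on $\{1,\dots,n\}$. Then $$\sup\{\operatorname{per}(f^\sigma): q\ge2,\ f\in F[D,q],\ \sigma\text{ a complete schedule}\}=n-T(D).$$
   Context: A digraph $D=(V,E)$ has $V=\{1,\dots,n\}$, $E\subseteq V^2$ (loops allowed). $T(D)$ is the number of trivial strong components of $D$, i.e. strong components consisting of a single vertex without a loop (equivalently, vertices lying on no cycle). With $[q]=\{0,\dots,q-1\}$, for $f:[q]^n\to[q]^n$, $\mathrm{IG}(f)$ is the digraph on $V$ with $(u,v)$ an arc iff $f_v$ depends essentially on $x_u$; $F[D,q]=\{f:\mathrm{IG}(f)=D\}$. A schedule is a sequence $\sigma=(\sigma_1,\dots,\sigma_t)$ of subsets of $V$; for $S\subseteq V$, $f^{(S)}_v(x)=f_v(x)$ if $v\in S$ and $x_v$ otherwise; $f^\sigma=f^{(\sigma_t)}\circ\dots\circ f^{(\sigma_1)}$. $\sigma$ is complete if $\bigcup_i\sigma_i=V$. For $g:[q]^n\to[q]^n$, a point $x$ is periodic if $g^k(x)=x$ for some $k\ge1$, and $\operatorname{per}(g)=\log_q$ of the number of periodic points of $g$. *)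

theory Defs
  imports Complex_Main "HOL-Library.FuncSet" "HOL-Library.Extended_Real"
    "Graph_Theory.Graph_Theory"
begin

definition trivial_count :: "nat pair_pre_digraph \<Rightarrow> nat" where
  "trivial_count D =
     card {C \<in> pre_digraph.sccs (with_proj D). \<exists>v. verts C = {v} \<and> (v, v) \<notin> arcs C}"

text \<open>Points of $[q]^n$ are extensional functions on \<open>{1..n}\<close>, so that equality of functions is
  equality of points.\<close>

definition configs :: "nat \<Rightarrow> nat \<Rightarrow> (nat \<Rightarrow> nat) set" where
  "configs q n = {1..n} \<rightarrow>\<^sub>E {..<q}"

definition depends_on ::
  "nat \<Rightarrow> nat \<Rightarrow> ((nat \<Rightarrow> nat) \<Rightarrow> (nat \<Rightarrow> nat)) \<Rightarrow> nat \<Rightarrow> nat \<Rightarrow> bool" where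
  "depends_on q n f v u \<longleftrightarrow>
     (\<exists>x \<in> configs q n. \<exists>y \<in> configs q n. (\<forall>w. w \<noteq> u \<longrightarrow> x w = y w) \<and> f x v \<noteq> f y v)"

definition interaction_graph ::
  "nat \<Rightarrow> nat \<Rightarrow> ((nat \<Rightarrow> nat) \<Rightarrow> (nat \<Rightarrow> nat)) \<Rightarrow> nat pair_pre_digraph" where
  "interaction_graph q n f =
     \<lparr> pverts = {1..n},
       parcs = {(u, v). u \<in> {1..n} \<and> v \<in> {1..n} \<and> depends_on q n f v u} \<rparr>"

definition networks ::
  "nat \<Rightarrow> nat \<Rightarrow> nat pair_pre_digraph \<Rightarrow> ((nat \<Rightarrow> nat) \<Rightarrow> (nat \<Rightarrow> nat)) set" where
  "networks q n D = {f \<in> configs q n \<rightarrow> configs q n. interaction_graph q n f = D}"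

definition update_on ::
  "((nat \<Rightarrow> nat) \<Rightarrow> (nat \<Rightarrow> nat)) \<Rightarrow> nat set \<Rightarrow> (nat \<Rightarrow> nat) \<Rightarrow> (nat \<Rightarrow> nat)" where
  "update_on f S x = (\<lambda>v. if v \<in> S then f x v else x v)"

text \<open>\<^const>\<open>fold\<close> applies the head of the list first, as required by
  $f^\sigma = f^{(\sigma_t)} \circ \dots \circ f^{(\sigma_1)}$.\<close>

definition run_schedule ::
  "((nat \<Rightarrow> nat) \<Rightarrow> (nat \<Rightarrow> nat)) \<Rightarrow> nat set list \<Rightarrow> (nat \<Rightarrow> nat) \<Rightarrow> (nat \<Rightarrow> nat)" where
  "run_schedule f \<sigma> = fold (update_on f) \<sigma>"

definition is_schedule :: "nat \<Rightarrow> nat set list \<Rightarrow> bool" where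
  "is_schedule n \<sigma> \<longleftrightarrow> (\<forall>S \<in> set \<sigma>. S \<subseteq> {1..n})"

definition complete_schedule :: "nat \<Rightarrow> nat set list \<Rightarrow> bool" where
  "complete_schedule n \<sigma> \<longleftrightarrow> is_schedule n \<sigma> \<and> \<Union> (set \<sigma>) = {1..n}"

definition periodic_points ::
  "nat \<Rightarrow> nat \<Rightarrow> ((nat \<Rightarrow> nat) \<Rightarrow> (nat \<Rightarrow> nat)) \<Rightarrow> (nat \<Rightarrow> nat) set" where
  "periodic_points q n g = {x \<in> configs q n. \<exists>k\<ge>1. (g ^^ k) x = x}"

definition per :: "nat \<Rightarrow> nat \<Rightarrow> ((nat \<Rightarrow> nat) \<Rightarrow> (nat \<Rightarrow> nat)) \<Rightarrow> real" where
  "per q n g = log (real q) (real (card (periodic_points q n g)))"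

end

(* Call a vertex cyclic if it lies on a cycle.

   Upper bound.  Two periodic points that agree on the cyclic vertices are equal, by induction
   along the ancestor relation: if they agree on the strict ancestors of an acyclic vertex v, then
   their orbits agree there at all times, and v is overwritten by a function of these values.

   Lower bound.  Take q = 2 and let every vertex compute the sum modulo 2 of its in-neighbours.
   Updating a shortest closed walk through a given vertex is a bijection: a chord can only run
   backwards, so the coordinates on the walk can be recovered one by one from the end.  Do this for
   every cyclic vertex, then update the acyclic vertices until they stabilise.  The resulting map
   is injective on the configurations that are stable at the acyclic vertices, and a configuration
   of the cyclic vertices extends to a stable one. *)
theory Submission
  imports Defs
begin

section \<open>Ancestors and cyclic vertices\<close>

definition ancestors :: "'a rel \<Rightarrow> 'a \<Rightarrow> 'a set" where
  "ancestors E v = {u. (u, v) \<in> E\<^sup>*}"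

text \<open>Such sets evolve autonomously: under any schedule their coordinates never read a
  coordinate outside.\<close>

definition pred_closed :: "'a rel \<Rightarrow> 'a set \<Rightarrow> bool" where
  "pred_closed E A \<longleftrightarrow> (\<forall>u v. (u, v) \<in> E \<longrightarrow> v \<in> A \<longrightarrow> u \<in> A)"

definition cyclic_verts :: "'a rel \<Rightarrow> 'a set" where
  "cyclic_verts E = {v. (v, v) \<in> E\<^sup>+}"

lemma pred_closedD: "pred_closed E A \<Longrightarrow> (u, v) \<in> E \<Longrightarrow> v \<in> A \<Longrightarrow> u \<in> A"
  by (auto simp: pred_closed_def)

lemma pred_closed_rtrancl:
  assumes "pred_closed E A" "(u, v) \<in> E\<^sup>*" "v \<in> A"
  shows "u \<in> A"
  using assms(2,3,1) by (induction rule: converse_rtrancl_induct) (auto dest: pred_closedD)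

lemma pred_closed_ancestors: "pred_closed E (ancestors E v)"
  by (auto simp: pred_closed_def ancestors_def intro: converse_rtrancl_into_rtrancl)

lemma pred_closed_strict_ancestors: "pred_closed E {u. (u, v) \<in> E\<^sup>+}"
  by (auto simp: pred_closed_def intro: trancl_into_trancl2)

lemma ancestors_refl: "v \<in> ancestors E v"
  by (simp add: ancestors_def)

lemma ancestors_psubset:
  assumes "(u, v) \<in> E\<^sup>*" "(v, u) \<notin> E\<^sup>*"
  shows "ancestors E u \<subset> ancestors E v"
  using assms unfolding ancestors_def by (auto intro: rtrancl_trans)

lemma ancestors_psubset_acyclic:
  assumes "(u, v) \<in> E\<^sup>+" "v \<notin> cyclic_verts E"
  shows "ancestors E u \<subset> ancestors E v"
  using assms by (intro ancestors_psubset) (auto simp: cyclic_verts_def trancl_rtrancl_trancl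
      dest: rtrancl_trancl_trancl)

lemma finite_ancestors:
  assumes "finite E"
  shows "finite (ancestors E v)"
proof -
  have "ancestors E v \<subseteq> insert v (Domain E)"
    by (auto simp: ancestors_def elim: converse_rtranclE)
  then show ?thesis
    by (rule finite_subset) (use assms in \<open>simp add: finite_Domain\<close>)
qed

text \<open>The digraph may have cycles, so induction along arcs is not well-founded. Strict
  inclusion of finite ancestor sets is, and it treats a strong component as one level, since its
  vertices share their ancestors.\<close>

lemma ancestors_induct [consumes 1, case_names step]:
  assumes "finite E"
    and "\<And>v. (\<And>u. ancestors E u \<subset> ancestors E v \<Longrightarrow> P u) \<Longrightarrow> P v"
  shows "P v"
proof (induction "card (ancestors E v)" arbitrary: v rule: less_induct)
  case less
  then show ?case
    using assms finite_ancestors psubset_card_mono by metis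
qed

lemma cyclic_verts_scc:
  assumes "v \<in> cyclic_verts E" "(u, v) \<in> E\<^sup>*" "(v, u) \<in> E\<^sup>*"
  shows "u \<in> cyclic_verts E"
  using assms unfolding cyclic_verts_def
  by (metis mem_Collect_eq rtrancl_trancl_trancl trancl_rtrancl_trancl)

text \<open>A chord from \<open>c j\<close> to \<open>c (Suc i)\<close> with \<open>j < i\<close>
  would skip part of the walk and contradict its minimal length.\<close>

lemma shortest_closed_walk:
  assumes "v \<in> cyclic_verts E"
  obtains c k where "k > 0" "c 0 = v" "c k = v" "\<And>i. i < k \<Longrightarrow> (c i, c (Suc i)) \<in> E"
    "\<And>i j. j < i \<Longrightarrow> i < k \<Longrightarrow> (c j, c (Suc i)) \<notin> E"
proof -
  define P where "P k \<longleftrightarrow> k > 0 \<and> (v, v) \<in> E ^^ k" for k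
  have "\<exists>k. P k"
    using assms by (auto simp: cyclic_verts_def trancl_power P_def)
  define k where "k = (LEAST k. P k)"
  have Pk: "P k" and k_le: "P m \<Longrightarrow> k \<le> m" for m
    using \<open>\<exists>k. P k\<close> LeastI_ex Least_le unfolding k_def by metis+
  then obtain c where c: "c 0 = v" "c k = v" "\<And>i. i < k \<Longrightarrow> (c i, c (Suc i)) \<in> E"
    by (auto simp: P_def relpow_fun_conv)
  have walk: "(c i, c (i + m)) \<in> E ^^ m" if "i + m \<le> k" for i m
    using that c(3) by (auto simp: relpow_fun_conv intro!: exI[of _ "\<lambda>l. c (i + l)"])
  have "(c j, c (Suc i)) \<notin> E" if "j < i" "i < k" for i j
  proof
    assume "(c j, c (Suc i)) \<in> E"
    moreover have "(c 0, c j) \<in> E ^^ j"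
      using walk[of 0 j] that by simp
    moreover have "(c (Suc i), c k) \<in> E ^^ (k - Suc i)"
      using walk[of "Suc i" "k - Suc i"] that by simp
    \<comment> \<open>There are \<open>j\<close> arcs up to \<open>c j\<close>, then the chord, then
      \<open>k - Suc i\<close> arcs up to \<open>c k\<close>; the total is below \<open>k\<close>
      because \<open>j < i\<close>.\<close>
    ultimately have "(v, v) \<in> E ^^ (Suc j + (k - Suc i))"
      unfolding relpow_add c by (auto intro!: relcompI)
    then have "P (Suc j + (k - Suc i))"
      by (simp add: P_def)
    then show False
      using k_le that by fastforce
  qed
  with c Pk show ?thesis
    by (intro that[of k c]) (auto simp: P_def)
qed

text \<open>Mapping \<open>v\<close> to the subgraph induced on \<open>{v}\<close> is a bijection
  from acyclic vertices to trivial components: the first arc of a closed walk through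
  \<open>v\<close> is a loop or leads to a second vertex of its component.\<close>

lemma trivial_count_eq:
  assumes "pair_wf_digraph D"
  shows "trivial_count D = card (pverts D - cyclic_verts (parcs D))"
proof -
  interpret pair_wf_digraph D by fact
  let ?G = "with_proj D"
  let ?A = "{C \<in> pre_digraph.sccs ?G. \<exists>v. verts C = {v} \<and> (v, v) \<notin> arcs C}"
  have reach: "(u, v) \<in> (parcs D)\<^sup>*" if "u \<rightarrow>\<^sup>*\<^bsub>?G\<^esub> v" for u v
    using reachable_rtranclI[OF that] by simp
  \<comment> \<open>The empty walk gives reachability only at a vertex of the digraph, hence the
    condition on \<open>v\<close>.\<close>
  have reach': "u \<rightarrow>\<^sup>*\<^bsub>?G\<^esub> v" if "(u, v) \<in> (parcs D)\<^sup>*" "v \<in> pverts D" for u v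
    using that(1) that(2)
  proof (induction rule: converse_rtrancl_induct)
    case base
    then show ?case by (intro reachable_refl) auto
  next
    case (step a b)
    then show ?case
      by (meson adj_reachable_trans)
  qed
  have "?A = (\<lambda>v. ?G \<restriction> {v}) ` (pverts D - cyclic_verts (parcs D))" (is "_ = ?B")
  proof (intro equalityI subsetI)
    fix C assume "C \<in> ?A"
    then obtain v where C: "C \<in> sccs" "verts C = {v}" "(v, v) \<notin> arcs C" by auto
    then have S: "{v} \<in> sccs_verts" and Cv: "C = ?G \<restriction> {v}"
      unfolding sccs_conv_sccs_verts by auto
    have "v \<in> pverts D"
      using S by (auto simp: sccs_verts_def dest: reachable_in_verts)
    moreover have "v \<notin> cyclic_verts (parcs D)"
    proof
      assume "v \<in> cyclic_verts (parcs D)"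
      then obtain u where u: "(v, u) \<in> parcs D" "(u, v) \<in> (parcs D)\<^sup>*"
        by (auto simp: cyclic_verts_def dest: tranclD)
      show False
      proof (cases "u = v")
        case True
        then show ?thesis using u C(3) Cv by auto
      next
        case False
        have "v \<rightarrow>\<^sup>*\<^bsub>?G\<^esub> u" "u \<rightarrow>\<^sup>*\<^bsub>?G\<^esub> v"
          using u in_arcsD2 \<open>v \<in> pverts D\<close> by (auto intro!: reach')
        then show ?thesis using S False by (auto simp: sccs_verts_def)
      qed
    qed
    ultimately show "C \<in> ?B" using Cv by auto
  next
    fix C assume "C \<in> ?B"
    then obtain v where v: "v \<in> pverts D" "v \<notin> cyclic_verts (parcs D)" "C = ?G \<restriction> {v}" by auto
    have "u = v" if "u \<rightarrow>\<^sup>*\<^bsub>?G\<^esub> v" "v \<rightarrow>\<^sup>*\<^bsub>?G\<^esub> u" for u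
    proof (rule ccontr)
      assume "u \<noteq> v"
      then have "(u, v) \<in> (parcs D)\<^sup>+" "(v, u) \<in> (parcs D)\<^sup>*"
        using reach[OF that(1)] reach[OF that(2)] by (auto dest: rtranclD)
      then show False
        using v(2) by (auto simp: cyclic_verts_def dest: rtrancl_trancl_trancl)
    qed
    then have "{v} \<in> sccs_verts"
      using v reach' by (auto simp: sccs_verts_def)
    then have "C \<in> sccs"
      using v sccs_conv_sccs_verts by auto
    moreover have "(v, v) \<notin> arcs C"
      using v by (auto simp: cyclic_verts_def)
    ultimately show "C \<in> ?A" using v by auto
  qed
  moreover have "inj_on (\<lambda>v. ?G \<restriction> {v}) (pverts D - cyclic_verts (parcs D))"
    by (rule inj_on_inverseI[where g = "\<lambda>C. the_elem (verts C)"]) auto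
  ultimately show ?thesis
    by (simp add: trivial_count_def card_image)
qed

section \<open>Locality and the upper bound\<close>

lemma finite_configs: "finite (configs q n)"
  by (auto simp: configs_def intro: finite_PiE)

lemma configs_eqI:
  assumes "x \<in> configs q n" "y \<in> configs q n" "\<And>v. v \<in> {1..n} \<Longrightarrow> x v = y v"
  shows "x = y"
  using assms(1,2) unfolding configs_def by (rule PiE_ext) (rule assms(3))

lemma configs_upd: "x \<in> configs q n \<Longrightarrow> v \<in> {1..n} \<Longrightarrow> a < q \<Longrightarrow> x(v := a) \<in> configs q n"
  unfolding configs_def by (auto simp: PiE_iff extensional_def)

locale network =
  fixes q n :: nat and D :: "nat pair_pre_digraph" and f :: "(nat \<Rightarrow> nat) \<Rightarrow> (nat \<Rightarrow> nat)"
  assumes f: "f \<in> networks q n D"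
begin

abbreviation E where "E \<equiv> parcs D"
abbreviation W where "W \<equiv> cyclic_verts E"

lemma E_iff: "(u, v) \<in> E \<longleftrightarrow> u \<in> {1..n} \<and> v \<in> {1..n} \<and> depends_on q n f v u"
  using f unfolding networks_def interaction_graph_def by auto

lemma E_verts: "(u, v) \<in> E \<Longrightarrow> u \<in> {1..n} \<and> v \<in> {1..n}"
  using E_iff by blast

lemma finite_E: "finite E"
  by (rule finite_subset[of _ "{1..n} \<times> {1..n}"]) (auto dest: E_verts)

lemma W_subset: "W \<subseteq> {1..n}"
  by (auto simp: cyclic_verts_def dest!: tranclD dest: E_verts)

lemma ancestors_subset: "v \<in> {1..n} \<Longrightarrow> ancestors E v \<subseteq> {1..n}"
proof
  fix u assume "v \<in> {1..n}" "u \<in> ancestors E v"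
  then show "u \<in> {1..n}"
    unfolding ancestors_def using E_verts by (metis converse_rtranclE mem_Collect_eq)
qed

lemma finite_W: "finite W"
  using W_subset finite_subset by blast

lemma f_configs: "x \<in> configs q n \<Longrightarrow> f x \<in> configs q n"
  using f unfolding networks_def by auto

text \<open>\<open>depends_on\<close> compares points differing in a single coordinate, so
  \<open>x\<close> is turned into \<open>y\<close> one coordinate at a time, through points that
  stay in \<open>configs q n\<close>.\<close>

lemma f_cong:
  assumes "x \<in> configs q n" "y \<in> configs q n" "v \<in> {1..n}"
    and "\<And>u. (u, v) \<in> E \<Longrightarrow> x u = y u"
  shows "f x v = f y v"
proof -
  \<comment> \<open>\<open>U\<close> only has to contain the coordinates where \<open>x\<close> and
    \<open>y\<close> differ; resetting \<open>x\<close> at \<open>u\<close> removes \<open>u\<close>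
    from the set to be treated.\<close>
  have agree: "f x v = f y v"
    if "finite U" "U \<subseteq> {1..n}" "{u. x u \<noteq> y u} \<subseteq> U" "x \<in> configs q n"
      "\<And>u. (u, v) \<in> E \<Longrightarrow> x u = y u" for U x
    using that
  proof (induction U arbitrary: x rule: finite_induct)
    case empty
    then have "x = y" by auto
    then show ?case by simp
  next
    case (insert u U)
    let ?x = "x(u := y u)"
    have x: "?x \<in> configs q n"
      using insert.prems \<open>y \<in> configs q n\<close> by (intro configs_upd) (auto simp: configs_def)
    have "f ?x v = f y v"
      using insert.prems by (intro insert.IH x) auto
    moreover have "f x v = f ?x v"
    proof (cases "(u, v) \<in> E")
      case True
      then have "?x = x" using insert.prems by auto
      then show ?thesis by simp
    next
      case False
      then have "\<not> depends_on q n f v u"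
        using E_iff insert.prems \<open>v \<in> {1..n}\<close> by auto
      then show ?thesis
        using insert.prems(3) x unfolding depends_on_def by (metis fun_upd_other)
    qed
    ultimately show ?case by simp
  qed
  moreover have "{u. x u \<noteq> y u} \<subseteq> {1..n}"
    using assms(1,2) unfolding configs_def by (blast dest: PiE_arb intro: trans sym)
  ultimately show ?thesis
    using assms(1,4) by (intro agree[of "{1..n}"]) auto
qed

section \<open>Runs of schedules on predecessor-closed sets\<close>

lemma update_configs:
  assumes "x \<in> configs q n" "S \<subseteq> {1..n}"
  shows "update_on f S x \<in> configs q n"
  using assms f_configs[OF assms(1)]
  by (auto simp: configs_def update_on_def PiE_iff extensional_def)

lemma run_configs:
  assumes "is_schedule n \<sigma>" "x \<in> configs q n"
  shows "run_schedule f \<sigma> x \<in> configs q n"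
  using assms
  by (induction \<sigma> arbitrary: x) (auto simp: run_schedule_def is_schedule_def update_configs)

lemma run_append: "run_schedule f (\<sigma> @ \<tau>) x = run_schedule f \<tau> (run_schedule f \<sigma> x)"
  by (simp add: run_schedule_def)

lemma update_agree:
  assumes "S \<subseteq> {1..n}" "x \<in> configs q n" "y \<in> configs q n" "pred_closed E A"
    and "\<And>u. u \<in> A \<Longrightarrow> x u = y u" "v \<in> A"
  shows "update_on f S x v = update_on f S y v"
  using assms by (auto simp: update_on_def intro!: f_cong dest: pred_closedD)

lemma run_agree:
  assumes "is_schedule n \<sigma>" "x \<in> configs q n" "y \<in> configs q n" "pred_closed E A"
    and "\<And>u. u \<in> A \<Longrightarrow> x u = y u" "v \<in> A"
  shows "run_schedule f \<sigma> x v = run_schedule f \<sigma> y v"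
  using assms
proof (induction \<sigma> arbitrary: x y)
  case Nil
  then show ?case by (simp add: run_schedule_def)
next
  case (Cons S \<sigma>)
  have "run_schedule f \<sigma> (update_on f S x) v = run_schedule f \<sigma> (update_on f S y) v"
    using Cons.prems
    by (intro Cons.IH update_configs update_agree[where A = A]) (auto simp: is_schedule_def)
  then show ?case by (simp add: run_schedule_def)
qed

text \<open>The first update of \<open>v\<close> reads only coordinates in \<open>A\<close>, where
  both runs agree, so it erases any initial difference at \<open>v\<close>. From then on
  \<open>insert v A\<close> is a predecessor-closed set of agreement.\<close>

lemma run_agree_updated:
  assumes "is_schedule n \<sigma>" "x \<in> configs q n" "y \<in> configs q n" "pred_closed E A"
    and "\<And>u. u \<in> A \<Longrightarrow> x u = y u" "\<And>u. (u, v) \<in> E \<Longrightarrow> u \<in> A" "v \<in> \<Union> (set \<sigma>)"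
  shows "run_schedule f \<sigma> x v = run_schedule f \<sigma> y v"
  using assms
proof (induction \<sigma> arbitrary: x y)
  case Nil
  then show ?case by simp
next
  case (Cons S \<sigma>)
  let ?x = "update_on f S x" and ?y = "update_on f S y"
  have S: "S \<subseteq> {1..n}" "is_schedule n \<sigma>"
    using Cons.prems(1) by (auto simp: is_schedule_def)
  have xy: "?x \<in> configs q n" "?y \<in> configs q n"
    using S Cons.prems by (simp_all add: update_configs)
  have agree: "?x u = ?y u" if "u \<in> A" for u
    using S Cons.prems that by (intro update_agree) auto
  have "run_schedule f \<sigma> ?x v = run_schedule f \<sigma> ?y v"
  proof (cases "v \<in> S")
    case True
    then have "?x v = ?y v"
      using S Cons.prems by (auto simp: update_on_def intro!: f_cong)
    moreover have "pred_closed E (insert v A)"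
      using Cons.prems by (auto simp: pred_closed_def)
    ultimately show ?thesis
      using S xy agree by (intro run_agree[where A = "insert v A"]) auto
  next
    case False
    then show ?thesis
      using S xy agree Cons.prems by (intro Cons.IH) auto
  qed
  then show ?case by (simp add: run_schedule_def)
qed

lemma funpow_run_agree:
  assumes "is_schedule n \<sigma>" "x \<in> configs q n" "y \<in> configs q n" "pred_closed E A"
    and "\<And>u. u \<in> A \<Longrightarrow> x u = y u" "v \<in> A"
  shows "(run_schedule f \<sigma> ^^ k) x v = (run_schedule f \<sigma> ^^ k) y v"
proof -
  let ?g = "run_schedule f \<sigma>"
  have conf: "(?g ^^ k) x \<in> configs q n" if "x \<in> configs q n" for k x
    using that assms(1) by (induction k) (auto intro: run_configs)
  have "\<forall>v\<in>A. (?g ^^ k) x v = (?g ^^ k) y v"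
    using assms by (induction k) (auto intro!: run_agree[where A = A] conf)
  then show ?thesis using assms by auto
qed

section \<open>Upper bound on the number of periodic points\<close>

lemma periodic_points_eqI:
  assumes \<sigma>: "complete_schedule n \<sigma>"
    and x: "x \<in> periodic_points q n (run_schedule f \<sigma>)"
    and y: "y \<in> periodic_points q n (run_schedule f \<sigma>)"
    and W: "\<And>w. w \<in> W \<Longrightarrow> x w = y w"
  shows "x = y"
proof -
  let ?g = "run_schedule f \<sigma>"
  have sched: "is_schedule n \<sigma>" and cov: "\<Union> (set \<sigma>) = {1..n}"
    using \<sigma> by (auto simp: complete_schedule_def)
  have xc: "x \<in> configs q n" and yc: "y \<in> configs q n"
    using x y by (auto simp: periodic_points_def)
  obtain k l where "k \<ge> 1" "l \<ge> 1" and k: "(?g ^^ k) x = x" and l: "(?g ^^ l) y = y"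
    using x y by (auto simp: periodic_points_def)
  have "((?g ^^ k) ^^ l) x = x"
    using k by (induction l) auto
  moreover have "((?g ^^ l) ^^ k) y = y"
    using l by (induction k) auto
  ultimately have kl: "(?g ^^ (k * l)) x = x" "(?g ^^ (k * l)) y = y"
    by (simp_all add: funpow_mult mult.commute)
  \<comment> \<open>The common period \<open>k * l\<close> is positive, so a first run can be split
    off: it overwrites \<open>v\<close>, and the other \<open>j\<close> runs preserve the
    agreement.\<close>
  obtain j where j: "k * l = Suc j"
    using \<open>k \<ge> 1\<close> \<open>l \<ge> 1\<close> not0_implies_Suc[of "k * l"] by fastforce
  have "v \<in> {1..n} \<longrightarrow> x v = y v" for v
    using finite_E
  proof (induction v rule: ancestors_induct)
    case (step v)
    show ?case
    proof (cases "v \<in> W \<or> v \<notin> {1..n}")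
      case True
      then show ?thesis using W by auto
    next
      case False
      \<comment> \<open>As \<open>v\<close> is acyclic, \<open>?A\<close> contains all in-neighbours
        of \<open>v\<close> but not \<open>v\<close> itself, and the induction hypothesis covers all
        of it.\<close>
      let ?A = "{u. (u, v) \<in> E\<^sup>+}"
      have agree: "x u = y u" if "u \<in> ?A" for u
      proof -
        have "u \<in> {1..n}"
          using that ancestors_subset[of v] False by (auto simp: ancestors_def)
        moreover have "ancestors E u \<subset> ancestors E v"
          using that False by (intro ancestors_psubset_acyclic) auto
        ultimately show ?thesis
          using step by blast
      qed
      have closed: "pred_closed E ?A"
        by (rule pred_closed_strict_ancestors)
      have gv: "?g x v = ?g y v"
        using sched xc yc closed agree False cov
        by (intro run_agree_updated[where A = ?A]) auto
      have gA: "?g x u = ?g y u" if "u \<in> ?A" for u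
        using sched xc yc closed agree that by (intro run_agree[where A = ?A]) auto
      have "(?g ^^ j) (?g x) v = (?g ^^ j) (?g y) v"
        using sched xc yc gv gA
        by (intro funpow_run_agree[where A = "insert v ?A"])
          (auto simp: pred_closed_def intro: run_configs trancl_into_trancl2)
      then show ?thesis
        using kl unfolding j funpow_Suc_right comp_apply by simp
    qed
  qed
  then show ?thesis
    using xc yc by (auto intro: configs_eqI)
qed

lemma card_periodic_points_le:
  assumes "complete_schedule n \<sigma>"
  shows "card (periodic_points q n (run_schedule f \<sigma>)) \<le> q ^ card W"
proof -
  let ?P = "periodic_points q n (run_schedule f \<sigma>)"
  have "inj_on (\<lambda>x. restrict x W) ?P"
    by (rule inj_onI) (metis assms periodic_points_eqI restrict_apply')
  moreover have "(\<lambda>x. restrict x W) ` ?P \<subseteq> W \<rightarrow>\<^sub>E {..<q}"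
    using W_subset by (auto simp: periodic_points_def configs_def)
  moreover have "finite (W \<rightarrow>\<^sub>E {..<q})"
    using finite_W by (auto intro: finite_PiE)
  ultimately have "card ?P \<le> card (W \<rightarrow>\<^sub>E {..<q})"
    by (rule card_inj_on_le)
  then show ?thesis
    using finite_W by (simp add: card_PiE)
qed

lemma per_le:
  assumes "complete_schedule n \<sigma>" "q \<ge> 2"
  shows "per q n (run_schedule f \<sigma>) \<le> card W"
proof (cases "card (periodic_points q n (run_schedule f \<sigma>)) = 0")
  \<comment> \<open>Here \<open>log\<close> takes its default value 0 at 0; monotonicity in the
    other case needs a positive argument.\<close>
  case True
  then show ?thesis by (simp add: per_def log_def)
next
  case False
  then have "per q n (run_schedule f \<sigma>) \<le> log q (real (q ^ card W))"
    using assms card_periodic_points_le[OF assms(1)] unfolding per_def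
    by (intro log_mono) (auto simp del: of_nat_power)
  then show ?thesis
    using assms by (simp add: log_nat_power)
qed

end

section \<open>Stabilising the acyclic vertices\<close>

context network
begin

abbreviation acyc where "acyc \<equiv> {1..n} - W"

text \<open>The set that the constructed schedule will permute.\<close>

definition stable_configs :: "(nat \<Rightarrow> nat) set" where
  "stable_configs = {x \<in> configs q n. \<forall>v \<in> acyc. f x v = x v}"

text \<open>An acyclic vertex settles after as many rounds as it has ancestors, itself included,
  hence after \<open>n\<close> rounds at the latest.\<close>

definition relax :: "(nat \<Rightarrow> nat) \<Rightarrow> (nat \<Rightarrow> nat)" where
  "relax = run_schedule f (replicate n acyc)"

lemma relax_eq_funpow: "relax = update_on f acyc ^^ n"
proof -
  have "fold (update_on f) (replicate m acyc) = update_on f acyc ^^ m" for m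
    by (induction m) (auto simp: funpow_swap1 fun_eq_iff)
  then show ?thesis
    by (simp add: relax_def run_schedule_def)
qed

lemma relax_configs: "x \<in> configs q n \<Longrightarrow> relax x \<in> configs q n"
  unfolding relax_def by (rule run_configs) (auto simp: is_schedule_def)

lemma relax_cyclic: "w \<in> W \<Longrightarrow> relax x w = x w"
proof -
  assume "w \<in> W"
  then have "(update_on f acyc ^^ m) x w = x w" for m
    by (induction m) (auto simp: update_on_def)
  then show ?thesis by (simp add: relax_eq_funpow)
qed

text \<open>Cyclic coordinates are frozen during the rounds, and an acyclic one can change after its
  first round only if an in-neighbour changed in the round before.\<close>

lemma relax_stable:
  assumes x: "x \<in> configs q n"
  shows "relax x \<in> stable_configs"
proof -
  let ?u = "update_on f acyc"
  have conf: "(?u ^^ m) x \<in> configs q n" for m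
    using x by (induction m) (auto intro: update_configs)
  have settle: "\<forall>m \<ge> card (ancestors E v). (?u ^^ Suc m) x v = (?u ^^ m) x v" for v
    using finite_E
  proof (induction v rule: ancestors_induct)
    case (step v)
    show ?case
    proof (intro allI impI)
      fix m assume m: "m \<ge> card (ancestors E v)"
      show "(?u ^^ Suc m) x v = (?u ^^ m) x v"
      proof (cases "v \<in> acyc")
        case False
        then show ?thesis unfolding funpow.simps comp_apply by (subst update_on_def) metis
      next
        case True
        \<comment> \<open>Since \<open>v\<close> is its own ancestor, round \<open>m\<close> has a
          preceding round \<open>m'\<close>. In-neighbours have strictly fewer ancestors, so they
          are already settled at \<open>m'\<close>.\<close>
        have "card (ancestors E v) > 0"
          using ancestors_refl finite_ancestors[OF finite_E] by (metis card_gt_0_iff empty_iff)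
        then obtain m' where m': "m = Suc m'"
          using m by (cases m) auto
        have "(?u ^^ Suc m') x u = (?u ^^ m') x u" if "(u, v) \<in> E" for u
        proof -
          have "ancestors E u \<subset> ancestors E v"
            using that True by (intro ancestors_psubset_acyclic) auto
          moreover from this have "card (ancestors E u) < card (ancestors E v)"
            by (intro psubset_card_mono finite_ancestors finite_E)
          ultimately show ?thesis
            using step m m' by auto
        qed
        then have "f ((?u ^^ Suc m') x) v = f ((?u ^^ m') x) v"
          using True by (intro f_cong conf) auto
        then show ?thesis
          using True by (simp add: m' update_on_def)
      qed
    qed
  qed
  have "f (relax x) v = relax x v" if v: "v \<in> acyc" for v
  proof -
    have "card (ancestors E v) \<le> n"
      using card_mono[OF _ ancestors_subset[of v]] v by simp
    then have "(?u ^^ Suc n) x v = (?u ^^ n) x v"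
      using settle by blast
    then show ?thesis
      using v by (simp add: relax_eq_funpow update_on_def)
  qed
  then show ?thesis
    using relax_configs[OF x] by (auto simp: stable_configs_def)
qed

lemma finite_stable: "finite stable_configs"
  using finite_configs by (auto simp: stable_configs_def)

lemma card_stable_ge:
  assumes "q > 0"
  shows "q ^ card W \<le> card stable_configs"
proof -
  \<comment> \<open>The filler 0 on acyclic vertices is arbitrary: \<open>relax\<close> recomputes
    these coordinates and keeps those in \<open>W\<close>, so \<open>z\<close> can be read off the
    result.\<close>
  define ext where "ext z = (\<lambda>v\<in>{1..n}. if v \<in> W then z v else 0)" for z :: "nat \<Rightarrow> nat"
  have ext: "ext z \<in> configs q n" if "z \<in> W \<rightarrow>\<^sub>E {..<q}" for z
    using that assms by (auto simp: ext_def configs_def)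
  have "relax (ext z) w = z w" if "w \<in> W" for z w
    using that W_subset by (auto simp: relax_cyclic ext_def)
  then have "inj_on (relax \<circ> ext) (W \<rightarrow>\<^sub>E {..<q})"
    by (intro inj_onI) (metis PiE_ext comp_apply)
  moreover have "(relax \<circ> ext) ` (W \<rightarrow>\<^sub>E {..<q}) \<subseteq> stable_configs"
    using ext relax_stable by auto
  ultimately have "card (W \<rightarrow>\<^sub>E {..<q}) \<le> card stable_configs"
    using finite_stable by (rule card_inj_on_le)
  then show ?thesis
    using finite_W by (simp add: card_PiE)
qed

end

section \<open>Networks with cancellation\<close>

text \<open>The orbit of \<open>x\<close> repeats by the pigeonhole principle, and injectivity
  strips the common initial steps until the repetition starts at \<open>x\<close>.\<close>

lemma inj_on_imp_periodic:
  assumes "finite X" "inj_on g X" "g ` X \<subseteq> X" "x \<in> X"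
  shows "\<exists>k\<ge>1. (g ^^ k) x = x"
proof -
  have mem: "(g ^^ k) x \<in> X" for k
    using assms by (induction k) auto
  have "\<not> inj (\<lambda>k. (g ^^ k) x)"
  proof
    assume "inj (\<lambda>k. (g ^^ k) x)"
    moreover have "finite (range (\<lambda>k. (g ^^ k) x))"
      by (rule finite_subset[OF _ assms(1)]) (use mem in auto)
    ultimately show False
      using finite_imageD by blast
  qed
  then obtain i j where "i < j" "(g ^^ i) x = (g ^^ j) x"
    unfolding inj_def by (metis linorder_neqE_nat)
  then show ?thesis
  proof (induction i arbitrary: j)
    case 0
    then show ?case by (intro exI[of _ j]) auto
  next
    case (Suc i)
    then obtain j' where j': "j = Suc j'"
      by (cases j) auto
    with Suc.prems have "(g ^^ i) x = (g ^^ j') x"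
      using inj_onD[OF assms(2)] mem by auto
    then show ?case using Suc.IH[of j'] Suc.prems j' by auto
  qed
qed

text \<open>This isolates what the lower bound takes from addition modulo 2: the equation at
  \<open>v\<close> can be solved for any one of its in-neighbours.\<close>

locale cancellative_network = network +
  assumes cancel: "\<lbrakk>(u, v) \<in> E; x \<in> configs q n; y \<in> configs q n;
    \<And>u'. (u', v) \<in> E \<Longrightarrow> u' \<noteq> u \<Longrightarrow> x u' = y u'; f x v = f y v\<rbrakk> \<Longrightarrow> x u = y u"
begin

text \<open>The restriction to a predecessor-closed set \<open>A\<close> is needed because injectivity is combined
  later with stability by induction along the ancestor relation.\<close>

definition reversible :: "nat set \<Rightarrow> bool" where
  "reversible S \<longleftrightarrow> S \<subseteq> {1..n} \<and>
     (\<forall>A. \<forall>x \<in> configs q n. \<forall>y \<in> configs q n. pred_closed E A \<longrightarrow>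
        (\<forall>v \<in> A. update_on f S x v = update_on f S y v) \<longrightarrow> (\<forall>v \<in> A. x v = y v))"

lemma reversible_cycle:
  assumes "v \<in> W"
  shows "\<exists>S. v \<in> S \<and> reversible S"
proof -
  obtain c k where k: "k > 0" and c0: "c 0 = v" and ck: "c k = v"
    and arc: "\<And>i. i < k \<Longrightarrow> (c i, c (Suc i)) \<in> E"
    and short: "\<And>i j. j < i \<Longrightarrow> i < k \<Longrightarrow> (c j, c (Suc i)) \<notin> E"
    using shortest_closed_walk[OF assms] by metis
  define S where "S = c ` {..<k}"
  have S: "S \<subseteq> {1..n}"
    using E_verts[OF arc] by (auto simp: S_def)
  \<comment> \<open>The index \<open>k\<close> is included because the walk closes up:
    \<open>c k\<close> equals \<open>c 0\<close>.\<close>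
  have c_in: "c i \<in> S" if "i \<le> k" for i
    using that k c0 ck by (cases "i = k") (auto simp: S_def intro!: image_eqI[of _ _ 0])
  have walk: "(c i, c j) \<in> E\<^sup>*" if "i \<le> j" "j \<le> k" for i j
    using that(1,2)
  proof (induction j rule: dec_induct)
    case (step m)
    then show ?case using arc[of m] by (auto intro: rtrancl_into_rtrancl)
  qed simp
  have conn: "(a, b) \<in> E\<^sup>*" if ab: "a \<in> S" "b \<in> S" for a b
  proof -
    obtain i j where "a = c i" "b = c j" "i \<le> k" "j \<le> k"
      using ab by (auto simp: S_def intro: less_imp_le)
    then show ?thesis
      using walk[of i k] walk[of 0 j] c0 ck by (auto intro: rtrancl_trans)
  qed
  have "x w = y w"
    if A: "pred_closed E A" and xc: "x \<in> configs q n" and yc: "y \<in> configs q n"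
      and eq: "\<And>v. v \<in> A \<Longrightarrow> update_on f S x v = update_on f S y v" and w: "w \<in> A" for A x y w
  proof -
    have off: "x u = y u" if "u \<in> A" "u \<notin> S" for u
      using eq[OF that(1)] that(2) by (simp add: update_on_def)
    show ?thesis
    proof (cases "w \<in> S")
      case True
      \<comment> \<open>\<open>S\<close> is strongly connected and meets the predecessor-closed set
        \<open>A\<close> in \<open>w\<close>, so \<open>A\<close> contains it and the updated values
        agree on all of \<open>S\<close>.\<close>
      have SA: "S \<subseteq> A"
        by (rule subsetI) (rule pred_closed_rtrancl[OF A conn[OF _ True] w])
      \<comment> \<open>Descending from \<open>i = k - 1\<close>, the equation at
        \<open>c (Suc i)\<close> is solved for \<open>c i\<close>. Its other in-neighbours are
        either outside \<open>S\<close>, hence not updated, or some \<open>c j\<close> with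
        \<open>j > i\<close>, hence already recovered.\<close>
      have "x (c i) = y (c i)" if "i < k" for i
        using that
      proof (induction "k - i" arbitrary: i rule: less_induct)
        case less
        note i = \<open>i < k\<close>
        have next_in: "c (Suc i) \<in> S"
          using c_in i by auto
        show ?case
        proof (rule cancel[OF arc[OF i] xc yc])
          show "f x (c (Suc i)) = f y (c (Suc i))"
            using eq[of "c (Suc i)"] next_in SA by (auto simp: update_on_def)
          fix u assume u: "(u, c (Suc i)) \<in> E" "u \<noteq> c i"
          then have "u \<in> A"
            using pred_closedD[OF A] next_in SA by blast
          show "x u = y u"
          proof (cases "u \<in> S")
            case True
            then obtain j where j: "j < k" "u = c j" by (auto simp: S_def)
            then have "i < j"
              using short[of j i] u i by (metis linorder_neqE_nat)
            then show ?thesis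
              using less.hyps[of j] j i by auto
          qed (use off \<open>u \<in> A\<close> in auto)
        qed
      qed
      then show ?thesis using True by (auto simp: S_def)
    qed (use off w in auto)
  qed
  then have "reversible S"
    using S unfolding reversible_def by blast
  then show ?thesis
    using c_in[of 0] c0 by auto
qed

lemma run_reversible:
  assumes "\<And>S. S \<in> set \<sigma> \<Longrightarrow> reversible S" "x \<in> configs q n" "y \<in> configs q n" "pred_closed E A"
    and "\<forall>v \<in> A. run_schedule f \<sigma> x v = run_schedule f \<sigma> y v"
  shows "\<forall>v \<in> A. x v = y v"
  using assms
proof (induction \<sigma> arbitrary: x y)
  case Nil
  then show ?case by (simp add: run_schedule_def)
next
  case (Cons S \<sigma>)
  have S: "reversible S"
    using Cons.prems by auto
  then have "S \<subseteq> {1..n}"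
    by (simp add: reversible_def)
  have "\<forall>v \<in> A. update_on f S x v = update_on f S y v"
  proof (rule Cons.IH)
    show "\<forall>v \<in> A. run_schedule f \<sigma> (update_on f S x) v = run_schedule f \<sigma> (update_on f S y) v"
      using Cons.prems(5) by (simp add: run_schedule_def)
  qed (use Cons.prems \<open>S \<subseteq> {1..n}\<close> in \<open>simp_all add: update_configs\<close>)
  then show ?case
    using S Cons.prems unfolding reversible_def by blast
qed

text \<open>After \<open>relax\<close> only the cyclic coordinates of the run of
  \<open>\<sigma>\<close> are known. Going up the ancestor order, stability determines an acyclic
  coordinate from earlier ones. For a cyclic \<open>v\<close>, the runs are shown to agree on all
  ancestors of \<open>v\<close>, and reversibility carries this back to \<open>x\<close> and
  \<open>y\<close>.\<close>

lemma relax_run_inj_on_stable: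
  assumes "\<And>S. S \<in> set \<sigma> \<Longrightarrow> reversible S"
  shows "inj_on (\<lambda>x. relax (run_schedule f \<sigma> x)) stable_configs"
proof (rule inj_onI)
  fix x y assume x: "x \<in> stable_configs" and y: "y \<in> stable_configs"
    and eq: "relax (run_schedule f \<sigma> x) = relax (run_schedule f \<sigma> y)"
  let ?h = "run_schedule f \<sigma>"
  have sched: "is_schedule n \<sigma>"
    using assms by (auto simp: is_schedule_def reversible_def)
  have xc: "x \<in> configs q n" and yc: "y \<in> configs q n"
    using x y by (auto simp: stable_configs_def)
  have hW: "?h x w = ?h y w" if "w \<in> W" for w
    using eq relax_cyclic[OF that] by metis
  have "v \<in> {1..n} \<longrightarrow> x v = y v" for v
    using finite_E
  proof (induction v rule: ancestors_induct)
    case (step v)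
    show ?case
    proof
      assume v: "v \<in> {1..n}"
      have anc_V: "u \<in> {1..n}" if "u \<in> ancestors E v" for u
        using that v ancestors_subset by blast
      show "x v = y v"
      proof (cases "v \<in> W")
        case False
        have "x u = y u" if "(u, v) \<in> E" for u
        proof -
          have "ancestors E u \<subset> ancestors E v"
            using that False by (intro ancestors_psubset_acyclic) auto
          then show ?thesis
            using step E_verts[OF that] by blast
        qed
        then have "f x v = f y v"
          using xc yc v by (intro f_cong) auto
        then show ?thesis
          using x y v False by (auto simp: stable_configs_def)
      next
        case True
        let ?A = "ancestors E v"
        have "?h x u = ?h y u" if u: "u \<in> ?A" for u
        proof (cases "(v, u) \<in> E\<^sup>*")
          \<comment> \<open>Here \<open>u\<close> is in the strong component of \<open>v\<close>, so
            it is cyclic and \<open>relax\<close> has kept its value.\<close>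
          case True
          then have "u \<in> W"
            using u by (intro cyclic_verts_scc[OF \<open>v \<in> W\<close>]) (auto simp: ancestors_def)
          then show ?thesis by (rule hW)
        next
          \<comment> \<open>Here \<open>u\<close> is strictly earlier: the induction hypothesis
            gives agreement of \<open>x\<close> and \<open>y\<close> on its ancestors, and running
            forwards preserves it.\<close>
          case False
          then have sub: "ancestors E u \<subset> ?A"
            using u by (intro ancestors_psubset) (auto simp: ancestors_def)
          have "x w = y w" if "w \<in> ancestors E u" for w
          proof -
            have "ancestors E w \<subseteq> ancestors E u"
              using that by (auto simp: ancestors_def intro: rtrancl_trans)
            then have "ancestors E w \<subset> ?A"
              using sub by (rule subset_psubset_trans)
            moreover from this have "w \<in> {1..n}"
              using ancestors_refl[of w E] anc_V by blast
            ultimately show ?thesis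
              using step by blast
          qed
          then show ?thesis
            using sched xc yc pred_closed_ancestors ancestors_refl
            by (intro run_agree[where A = "ancestors E u"]) auto
        qed
        then have "\<forall>u \<in> ?A. x u = y u"
          using run_reversible[OF assms xc yc pred_closed_ancestors] by blast
        then show ?thesis
          using ancestors_refl by fastforce
      qed
    qed
  qed
  then show "x = y"
    using xc yc by (auto intro: configs_eqI)
qed

section \<open>A schedule attaining the bound\<close>

lemma exists_complete_schedule:
  assumes "q \<ge> 2"
  shows "\<exists>\<sigma>. complete_schedule n \<sigma> \<and> per q n (run_schedule f \<sigma>) \<ge> card W"
proof -
  obtain S where S: "\<And>w. w \<in> W \<Longrightarrow> w \<in> S w \<and> reversible (S w)"
    using reversible_cycle by metis
  define \<sigma>' where "\<sigma>' = map S (sorted_list_of_set W)"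
  define \<sigma> where "\<sigma> = \<sigma>' @ replicate n acyc"
  have rev: "reversible T" if "T \<in> set \<sigma>'" for T
    using that S finite_W by (auto simp: \<sigma>'_def)
  have sched': "is_schedule n \<sigma>'"
    using rev by (auto simp: is_schedule_def reversible_def)
  have complete: "complete_schedule n \<sigma>"
    unfolding complete_schedule_def
  proof
    show sched: "is_schedule n \<sigma>"
      using sched' by (auto simp: \<sigma>_def is_schedule_def)
    \<comment> \<open>A cyclic vertex lies in its own set \<open>S v\<close>. An acyclic one lies in
      the relaxation rounds, of which there is at least one because \<open>v\<close> in
      \<open>{1..n}\<close> forces \<open>n > 0\<close>.\<close>
    have "v \<in> \<Union> (set \<sigma>)" if "v \<in> {1..n}" for v
      using that S finite_W by (cases "v \<in> W") (auto simp: \<sigma>_def \<sigma>'_def)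
    then show "\<Union> (set \<sigma>) = {1..n}"
      using sched by (auto simp: is_schedule_def)
  qed
  have run: "run_schedule f \<sigma> = (\<lambda>x. relax (run_schedule f \<sigma>' x))"
    by (auto simp: \<sigma>_def run_append relax_def)
  have "inj_on (run_schedule f \<sigma>) stable_configs"
    unfolding run by (rule relax_run_inj_on_stable[OF rev])
  moreover have "run_schedule f \<sigma> ` stable_configs \<subseteq> stable_configs"
    unfolding run using run_configs[OF sched'] relax_stable by (auto simp: stable_configs_def)
  \<comment> \<open>An injective self-map of a finite set makes all its points periodic.\<close>
  ultimately have "stable_configs \<subseteq> periodic_points q n (run_schedule f \<sigma>)"
    using inj_on_imp_periodic[OF finite_stable] by (auto simp: periodic_points_def stable_configs_def)
  moreover have "finite (periodic_points q n (run_schedule f \<sigma>))"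
    using finite_configs by (auto simp: periodic_points_def)
  ultimately have "card stable_configs \<le> card (periodic_points q n (run_schedule f \<sigma>))"
    by (intro card_mono)
  then have "q ^ card W \<le> card (periodic_points q n (run_schedule f \<sigma>))"
    using card_stable_ge assms by linarith
  moreover have "0 < q ^ card W"
    using assms by simp
  ultimately have "log q (real (q ^ card W)) \<le> per q n (run_schedule f \<sigma>)"
    using assms unfolding per_def by (intro log_mono) (auto simp del: of_nat_power)
  then show ?thesis
    using complete assms by (auto simp: log_nat_power)
qed

end

section \<open>The parity network\<close>

definition parity_net :: "nat \<Rightarrow> nat rel \<Rightarrow> (nat \<Rightarrow> nat) \<Rightarrow> (nat \<Rightarrow> nat)" where
  "parity_net n E x = (\<lambda>v\<in>{1..n}. (\<Sum>u | (u, v) \<in> E. x u) mod 2)"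

text \<open>The contribution of the other in-neighbours cancels, and two values below 2 with the
  same parity are equal.\<close>

lemma parity_net_cancel:
  assumes "finite E" "(u, v) \<in> E" "v \<in> {1..n}" "x u < 2" "y u < 2"
    and "\<And>u'. (u', v) \<in> E \<Longrightarrow> u' \<noteq> u \<Longrightarrow> x u' = y u'"
    and "parity_net n E x v = parity_net n E y v"
  shows "x u = y u"
proof -
  have fin: "finite {u. (u, v) \<in> E}"
    by (rule finite_subset[of _ "Domain E"]) (use assms in \<open>auto simp: finite_Domain\<close>)
  have split: "(\<Sum>u | (u, v) \<in> E. z u) = z u + sum z ({u. (u, v) \<in> E} - {u})" for z :: "nat \<Rightarrow> nat"
    using fin assms by (intro sum.remove) auto
  have "sum x ({u. (u, v) \<in> E} - {u}) = sum y ({u. (u, v) \<in> E} - {u})" (is "?s = _")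
    using assms by (intro sum.cong) auto
  then have "(x u + ?s) mod 2 = (y u + ?s) mod 2"
    using assms split[of x] split[of y] by (simp add: parity_net_def)
  then show ?thesis
    using assms(4,5) by presburger
qed

lemma cancellative_parity_net:
  assumes "pair_wf_digraph D" "pverts D = {1..n}"
  shows "cancellative_network 2 n D (parity_net n (parcs D))"
proof -
  interpret pair_wf_digraph D by fact
  let ?E = "parcs D" and ?f = "parity_net n (parcs D)"
  have E: "u \<in> {1..n} \<and> v \<in> {1..n}" if "(u, v) \<in> ?E" for u v
    using that in_arcsD1 in_arcsD2 assms(2) by auto
  have fin: "finite ?E"
    by (rule finite_subset[of _ "{1..n} \<times> {1..n}"]) (auto dest: E)
  have lt: "x u < 2" if "x \<in> configs 2 n" "u \<in> {1..n}" for x u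
    using that by (auto simp: configs_def)
  have dep: "depends_on 2 n ?f v u \<longleftrightarrow> (u, v) \<in> ?E" if "v \<in> {1..n}" "u \<in> {1..n}" for u v
  proof
    assume "depends_on 2 n ?f v u"
    then obtain x y where xy: "\<forall>w. w \<noteq> u \<longrightarrow> x w = y w" "?f x v \<noteq> ?f y v"
      by (auto simp: depends_on_def)
    show "(u, v) \<in> ?E"
    proof (rule ccontr)
      assume "(u, v) \<notin> ?E"
      then have "(\<Sum>u | (u, v) \<in> ?E. x u) = (\<Sum>u | (u, v) \<in> ?E. y u)"
        using xy by (intro sum.cong) auto
      then show False using xy by (auto simp: parity_net_def split: if_splits)
    qed
  next
    assume uv: "(u, v) \<in> ?E"
    let ?x = "\<lambda>v\<in>{1..n}. 0 :: nat"
    have x: "?x \<in> configs 2 n" by (auto simp: configs_def)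
    then have y: "?x(u := 1) \<in> configs 2 n"
      using that by (intro configs_upd) auto
    \<comment> \<open>The zero point and its modification at \<open>u\<close> agree elsewhere; equal
      outputs at \<open>v\<close> would force 0 = 1 by cancellation.\<close>
    have "?f ?x v \<noteq> ?f (?x(u := 1)) v"
      using parity_net_cancel[OF fin uv \<open>v \<in> {1..n}\<close>, of ?x "?x(u := 1)"] that by auto
    then show "depends_on 2 n ?f v u"
      unfolding depends_on_def using x y by (intro bexI[OF _ x] bexI[OF _ y]) auto
  qed
  have "interaction_graph 2 n ?f = D"
  proof (rule pair_pre_digraph.equality)
    show "parcs (interaction_graph 2 n ?f) = ?E"
      using dep E unfolding interaction_graph_def by fastforce
  qed (simp_all add: interaction_graph_def assms(2))
  moreover have "?f \<in> configs 2 n \<rightarrow> configs 2 n"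
    by (auto simp: configs_def parity_net_def)
  ultimately show ?thesis
    by unfold_locales (auto simp: networks_def intro: parity_net_cancel[OF fin] lt dest: E)
qed

section \<open>The supremum\<close>

theorem theorem6:
  fixes n :: nat and D :: "nat pair_pre_digraph"
  assumes "pair_wf_digraph D" and "pverts D = {1..n}"
  shows "Sup {ereal (per q n (run_schedule f \<sigma>)) | q f \<sigma>.
            q \<ge> 2 \<and> f \<in> networks q n D \<and> complete_schedule n \<sigma>}
         = ereal (real n - real (trivial_count D))"
proof -
  let ?W = "cyclic_verts (parcs D)"
  interpret parity: cancellative_network 2 n D "parity_net n (parcs D)"
    using assms by (rule cancellative_parity_net)
  \<comment> \<open>The inequality makes the natural subtraction exact, so that it survives the
    passage to reals.\<close>
  have "card ({1..n} - ?W) = n - card ?W" "card ?W \<le> n"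
    using parity.W_subset parity.finite_W card_mono[OF _ parity.W_subset]
    by (simp_all add: card_Diff_subset)
  then have value_eq: "real n - real (trivial_count D) = card ?W"
    using trivial_count_eq[OF assms(1)] assms(2) by simp
  \<comment> \<open>The supremum is attained already at \<open>q = 2\<close>, by the parity
    network.\<close>
  obtain \<sigma> where \<sigma>: "complete_schedule n \<sigma>"
    "card ?W \<le> per 2 n (run_schedule (parity_net n (parcs D)) \<sigma>)"
    using parity.exists_complete_schedule by auto
  show ?thesis
    unfolding value_eq
  proof (rule antisym)
    show "Sup {ereal (per q n (run_schedule f \<sigma>)) | q f \<sigma>.
        q \<ge> 2 \<and> f \<in> networks q n D \<and> complete_schedule n \<sigma>} \<le> ereal (card ?W)"
      by (intro Sup_least) (auto dest!: network.intro intro: network.per_le)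
    show "ereal (card ?W) \<le> Sup {ereal (per q n (run_schedule f \<sigma>)) | q f \<sigma>.
        q \<ge> 2 \<and> f \<in> networks q n D \<and> complete_schedule n \<sigma>}"
    proof (rule Sup_upper2)
      show "ereal (per 2 n (run_schedule (parity_net n (parcs D)) \<sigma>)) \<in>
          {ereal (per q n (run_schedule f \<sigma>)) | q f \<sigma>.
            q \<ge> 2 \<and> f \<in> networks q n D \<and> complete_schedule n \<sigma>}"
        using \<sigma>(1) parity.f by blast
    qed (use \<sigma>(2) in simp)
  qed
qed

end
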